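(* Let $a<b$ be real numbers, let $\alpha\in(1,2]$, $\beta\in[0,\alpha-1]$, and let $q\in C([a,b],\mathbb{R})$. Assume that the equation $$D_{a^+}^{\alpha}u+q(t)u=0,\quad t\in[a,b],$$ has a nontrivial solution $u$ satisfying the boundary conditions $$u(a)=0,\qquad D_{a^+}^{\beta}u(b)=0,$$ and $u(t)\neq 0$ for all $t\in(a,b)$. Then $$\int_a^b q_+(t)\,dt>\Gamma(\alpha)\left(\frac{2\alpha-2-\beta}{(b-a)(\alpha-1)}\right)^{\alpha-1}\left(\frac{2\alpha-2-\beta}{\alpha-1-\beta}\right)^{\alpha-1-\beta},$$ where $q_+(t)=\max\{q(t),0\}$, and where for $\beta=\alpha-1$ the last factor is interpreted as $1$.
   Context: For $\nu>0$, the Riemann-Liouville fractional integral of order $\nu$ of $u:[a,b]\to\mathbb{R}$ is $I_{a^+}^{\nu}u(t)=\frac{1}{\Gamma(\nu)}\int_a^t(t-s)^{\nu-1}u(s)\,ds$, and $I_{a^+}^{0}u=u$. For a positive integer $n$ and $n-1<\gamma\le n$, the Riemann-Liouville fractional derivative of order $\gamma$ is $D_{a^+}^{\gamma}u(t)=\frac{d^n}{dt^n}I_{a^+}^{n-\gamma}u(t)$ (so for $\gamma=n$ it is the classical $n$-th derivative), and $D_{a^+}^{0}u=u$. Derivatives at the endpoints of $[a,b]$ are one-sided. A solution is a continuous function $u:[a,b]\to\mathbb{R}$ for which $D_{a^+}^{\alpha}u$ is defined on $[a,b]$ and which satisfies the equation on $[a,b]$. Nontrivial means not identically zero. *)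

theory Defs
  imports "HOL-Analysis.Analysis"
begin

(* The integrals are Henstock-Kurzweil integrals; for u continuous on [a,t] the integrand is
   absolutely integrable, so they coincide with the Lebesgue ones. The value 0 that powr takes
   at s = t concerns a single point only. *)
definition RL_integral :: "real \<Rightarrow> real \<Rightarrow> (real \<Rightarrow> real) \<Rightarrow> real \<Rightarrow> real" where
  "RL_integral a \<nu> u t =
     (if \<nu> = 0 then u t
      else 1 / Gamma \<nu> * integral {a..t} (\<lambda>s. (t - s) powr (\<nu> - 1) * u s))"

(* f has n-th derivative y at x, all derivatives being taken within S (hence one-sided at the
   endpoints of an interval). As usual, the (n+1)-st derivative at x requires the n-th derivative
   to exist at x and at all points of S close to x; g is that n-th derivative. *)
primrec has_nth_derivative_within ::
  "nat \<Rightarrow> (real \<Rightarrow> real) \<Rightarrow> real \<Rightarrow> real \<Rightarrow> real set \<Rightarrow> bool" where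
  "has_nth_derivative_within 0 f y x S \<longleftrightarrow> f x = y"
| "has_nth_derivative_within (Suc n) f y x S \<longleftrightarrow>
     (\<exists>g. has_nth_derivative_within n f (g x) x S
        \<and> (\<forall>\<^sub>F t in at x within S. has_nth_derivative_within n f (g t) t S)
        \<and> (g has_real_derivative y) (at x within S))"

(* The Riemann-Liouville derivative of order \<gamma> \<ge> 0 of u : [a,b] \<rightarrow> \<real> is defined at t and equals y.
   For \<gamma> > 0, n = nat \<lceil>\<gamma>\<rceil> is the positive integer with n - 1 < \<gamma> \<le> n;
   for \<gamma> = 0 it is 0, and the derivative is u itself. *)
definition has_RL_derivative ::
  "real \<Rightarrow> real \<Rightarrow> real \<Rightarrow> (real \<Rightarrow> real) \<Rightarrow> real \<Rightarrow> real \<Rightarrow> bool" where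
  "has_RL_derivative a b \<gamma> u y t \<longleftrightarrow>
     (let n = nat \<lceil>\<gamma>\<rceil>
      in has_nth_derivative_within n (RL_integral a (real n - \<gamma>) u) y t {a..b})"

definition RL_solution ::
  "real \<Rightarrow> real \<Rightarrow> real \<Rightarrow> (real \<Rightarrow> real) \<Rightarrow> (real \<Rightarrow> real) \<Rightarrow> bool" where
  "RL_solution a b \<alpha> q u \<longleftrightarrow>
     continuous_on {a..b} u \<and>
     (\<forall>t\<in>{a..b}. \<exists>v. has_RL_derivative a b \<alpha> u v t \<and> v + q t * u t = 0)"

end

theory Submission
  imports Defs
begin

text \<open>Write \<open>p = \<alpha> - 1\<close>, \<open>r = \<alpha> - 1 - \<beta>\<close> and \<open>h = q u\<close>, so that \<open>D\<^sup>\<alpha> u = - h\<close>. The idea is the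
  one of Lyapunov: turn the boundary value problem into an integral equation with a nonnegative
  Green function, evaluate it where \<open>\<bar>u\<bar>\<close> is largest, and bound the Green function by its maximum.

  Inverting the fractional derivative. The function \<open>w = I\<^bsup>2 - \<alpha>\<^esup> u\<close> is twice differentiable with
  \<open>w'' = - h\<close> and \<open>w(a) = 0\<close>, hence \<open>w = I k\<close> for \<open>k = w' = c - I h\<close>. By the semigroup law
  \<open>I\<^sup>\<mu> I\<^sup>\<nu> = I\<^bsup>\<mu> + \<nu>\<^esup>\<close>, applying \<open>I\<^bsup>\<alpha> - 1\<^esup>\<close> gives \<open>I u = I (c I\<^bsup>\<alpha> - 1\<^esup> 1 - I\<^sup>\<alpha> h)\<close>, and
  differentiating gives \<open>u = c I\<^bsup>\<alpha> - 1\<^esup> 1 - I\<^sup>\<alpha> h\<close> (lemma \<open>RL_derivative_inversion\<close>). The semigroup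
  law is Fubini's theorem together with Euler's Beta integral, which says that the kernels
  \<open>x\<^bsup>\<nu> - 1\<^esup> / \<Gamma>(\<nu>)\<close> are closed under convolution. The condition \<open>D\<^sup>\<beta> u(b) = 0\<close> then determines
  \<open>c\<close> (lemma \<open>RL_derivative_boundary_value\<close>), and \<open>\<Gamma>(\<alpha>) u(t) = \<integral> g(t,s) q(s) u(s) ds\<close> with
  \<open>g(t,s) = (t - a)\<^sup>p ((b - s) / (b - a))\<^sup>r - (t - s)\<^sub>+\<^sup>p\<close> (lemma \<open>green_representation\<close>).

  Estimating. One has \<open>0 \<le> g(t,s) \<le> \<phi>(s)\<close> where \<open>\<phi>(s) = g(s,s) = (s - a)\<^sup>p ((b - s) / (b - a))\<^sup>r\<close>,
  and \<open>\<phi>\<close> attains its maximum \<open>M\<close> over \<open>[a,b]\<close> at exactly one point; \<open>\<Gamma>(\<alpha>) / M\<close> is the constant of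
  the theorem. Since \<open>u\<close> has constant sign, \<open>\<bar>u\<bar>\<close> satisfies the same integral equation, and at a
  point where it is maximal one obtains \<open>\<Gamma>(\<alpha>) \<le> \<integral> \<phi> q\<^sub>+\<close>. As \<open>\<phi> < M\<close> off one point and \<open>q\<^sub>+\<close>
  is continuous and not zero, \<open>\<integral> \<phi> q\<^sub>+ < M \<integral> q\<^sub>+\<close>.\<close>

section \<open>Convolution of the fractional kernels\<close>

text \<open>The normalised kernel of \<open>I\<^sup>\<nu>\<close>, extended by zero to the whole line. Fractional integrals become
  convolutions over the line, so Fubini's theorem needs no bookkeeping of triangular domains.\<close>

definition RL_kernel :: "real \<Rightarrow> real \<Rightarrow> real" where
  "RL_kernel \<nu> x = (if 0 < x then x powr (\<nu> - 1) / Gamma \<nu> else 0)"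

lemma RL_kernel_nonneg: "0 < \<nu> \<Longrightarrow> 0 \<le> RL_kernel \<nu> x"
  by (simp add: RL_kernel_def less_imp_le)

lemma RL_kernel_measurable [measurable]: "RL_kernel \<nu> \<in> borel_measurable borel"
  unfolding RL_kernel_def by measurable

text \<open>This is the Beta integral \<open>B(\<nu>,\<mu>) = \<Gamma>(\<mu>) \<Gamma>(\<nu>) / \<Gamma>(\<mu> + \<nu>)\<close>: by homogeneity of the kernels it
  is enough to treat \<open>t = 1\<close>, and the general case follows by the substitution \<open>s \<mapsto> s / t\<close>.\<close>

lemma RL_kernel_convolution:
  assumes "0 < \<mu>" "0 < \<nu>"
  shows "has_bochner_integral lborel (\<lambda>s. RL_kernel \<mu> (t - s) * RL_kernel \<nu> s) (RL_kernel (\<mu> + \<nu>) t)"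
proof (cases "0 < t")
  case False
  then have "(\<lambda>s. RL_kernel \<mu> (t - s) * RL_kernel \<nu> s) = (\<lambda>s. 0)"
    by (auto simp: RL_kernel_def fun_eq_iff)
  then show ?thesis using False has_bochner_integral_zero[of lborel]
    by (simp only:) (simp add: RL_kernel_def)
next
  case True
  note G = Gamma_real_pos[OF assms(1)] Gamma_real_pos[OF assms(2)]
  define g where "g = (\<lambda>s. RL_kernel \<mu> (1 - s) * RL_kernel \<nu> s)"
  have nn: "0 \<le> g s" for s
    unfolding g_def using assms by (intro mult_nonneg_nonneg RL_kernel_nonneg)
  have m: "g \<in> borel_measurable borel" unfolding g_def by measurable
  have "((\<lambda>s. s powr (\<nu> - 1) * (1 - s) powr (\<mu> - 1) / (Gamma \<mu> * Gamma \<nu>))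
      has_integral (Beta \<nu> \<mu> / (Gamma \<mu> * Gamma \<nu>))) {0..1}"
    by (intro has_integral_divide has_integral_Beta_real assms)
  moreover have "Beta \<nu> \<mu> / (Gamma \<mu> * Gamma \<nu>) = 1 / Gamma (\<mu> + \<nu>)"
    using G by (simp add: Beta_def add.commute)
  ultimately have "((\<lambda>s. if s \<in> {0..1} then s powr (\<nu> - 1) * (1 - s) powr (\<mu> - 1) / (Gamma \<mu> * Gamma \<nu>) else 0)
      has_integral 1 / Gamma (\<mu> + \<nu>)) UNIV"
    by (subst has_integral_restrict_UNIV) simp
  moreover have "(\<lambda>s. if s \<in> {0..1} then s powr (\<nu> - 1) * (1 - s) powr (\<mu> - 1) / (Gamma \<mu> * Gamma \<nu>) else 0) = g"
    by (auto simp: fun_eq_iff g_def RL_kernel_def)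
  ultimately have "integral\<^sup>N lborel g = ennreal (1 / Gamma (\<mu> + \<nu>))"
    using nn m by (intro nn_integral_has_integral_lborel) auto
  then have "has_bochner_integral lborel g (1 / Gamma (\<mu> + \<nu>))"
    using nn m assms by (intro has_bochner_integral_nn_integral) (auto simp: less_imp_le)
  then have "has_bochner_integral lborel (\<lambda>s. g (0 + (1 / t) * s)) ((1 / Gamma (\<mu> + \<nu>)) /\<^sub>R \<bar>1 / t\<bar>)"
    using True by (subst (asm) lborel_has_bochner_integral_real_affine_iff[where c="1/t" and t=0]) auto
  then have "has_bochner_integral lborel (\<lambda>s. t powr (\<mu> + \<nu> - 2) * g (0 + (1 / t) * s))
      (t powr (\<mu> + \<nu> - 2) * ((1 / Gamma (\<mu> + \<nu>)) /\<^sub>R \<bar>1 / t\<bar>))"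
    by (intro has_bochner_integral_mult_right) auto
  moreover have "t powr (\<mu> + \<nu> - 2) * ((1 / Gamma (\<mu> + \<nu>)) /\<^sub>R \<bar>1 / t\<bar>) = RL_kernel (\<mu> + \<nu>) t"
  proof -
    have "t powr (\<mu> + \<nu> - 2) * t powr 1 = t powr (\<mu> + \<nu> - 1)"
      by (subst powr_add[symmetric]) (simp add: algebra_simps)
    then show ?thesis using True by (simp add: RL_kernel_def)
  qed
  moreover have "t powr (\<mu> + \<nu> - 2) * g (0 + (1 / t) * s) = RL_kernel \<mu> (t - s) * RL_kernel \<nu> s" for s
  proof (cases "0 < s \<and> s < t")
    case in01: True
    have e: "1 - s / t = (t - s) / t" using True by (simp add: field_simps)
    have "t powr (\<mu> + \<nu> - 2) = t powr (\<mu> - 1) * t powr (\<nu> - 1)"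
      by (subst powr_add[symmetric]) (simp add: algebra_simps)
    then show ?thesis using in01 True
      by (simp add: g_def RL_kernel_def e powr_divide)
  next
    case False
    then show ?thesis using True by (auto simp: g_def RL_kernel_def zero_less_divide_iff)
  qed
  ultimately show ?thesis by simp
qed

lemma RL_kernel_convolution_shift:
  assumes "0 < \<mu>" "0 < \<nu>"
  shows "has_bochner_integral lborel (\<lambda>s. RL_kernel \<mu> (t - s) * RL_kernel \<nu> (s - r)) (RL_kernel (\<mu> + \<nu>) (t - r))"
  using RL_kernel_convolution[OF assms, of "t - r"]
  by (subst (asm) lborel_has_bochner_integral_real_affine_iff[where c=1 and t="-r"]) (auto simp: algebra_simps)

text \<open>The singular kernel must be dominated by something integrable. The kernel of order 1 is the
  Heaviside function, so the convolution of the kernels of orders \<open>\<nu>\<close> and 1, started at \<open>a - 1\<close> in order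
  to be 1 at every point of the support of \<open>F\<close>, is such a bound.\<close>

lemma RL_kernel_integrable:
  assumes "0 < \<nu>" and m: "F \<in> borel_measurable borel"
    and bdd: "\<And>s. \<bar>F s\<bar> \<le> C" and left: "\<And>s. s < a \<Longrightarrow> F s = 0"
  shows "integrable lborel (\<lambda>s. RL_kernel \<nu> (t - s) * F s)"
proof (rule Bochner_Integration.integrable_bound)
  show "integrable lborel (\<lambda>s. C * (RL_kernel \<nu> (t - s) * RL_kernel 1 (s - (a - 1))))"
    using RL_kernel_convolution_shift[OF assms(1), of 1 t "a - 1"]
    by (intro integrable_mult_right) (auto simp: has_bochner_integral_iff)
  show "(\<lambda>s. RL_kernel \<nu> (t - s) * F s) \<in> borel_measurable lborel"
    using m by measurable
  have "\<bar>RL_kernel \<nu> (t - s) * F s\<bar> \<le> \<bar>C * (RL_kernel \<nu> (t - s) * RL_kernel 1 (s - (a - 1)))\<bar>" for s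
  proof (cases "s < a")
    case False
    then have "RL_kernel 1 (s - (a - 1)) = 1" by (simp add: RL_kernel_def)
    moreover have "\<bar>RL_kernel \<nu> (t - s)\<bar> * \<bar>F s\<bar> \<le> \<bar>RL_kernel \<nu> (t - s)\<bar> * \<bar>C\<bar>"
      using bdd[of s] by (intro mult_left_mono) auto
    ultimately show ?thesis by (simp add: abs_mult mult.commute)
  qed (simp add: left)
  then show "AE s in lborel. norm (RL_kernel \<nu> (t - s) * F s)
      \<le> norm (C * (RL_kernel \<nu> (t - s) * RL_kernel 1 (s - (a - 1))))" by simp
qed

text \<open>Associativity of convolution. Absolute integrability of the double integrand comes from
  performing the inner integral in the order where it is the Beta integral.\<close>

lemma RL_kernel_iterated:
  assumes pos: "0 < \<mu>" "0 < \<nu>" and m[measurable]: "F \<in> borel_measurable borel"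
    and bdd: "\<And>s. \<bar>F s\<bar> \<le> C" and left: "\<And>s. s < a \<Longrightarrow> F s = 0"
  shows "has_bochner_integral lborel
    (\<lambda>s. RL_kernel \<mu> (t - s) * (\<integral>r. RL_kernel \<nu> (s - r) * F r \<partial>lborel))
    (\<integral>r. RL_kernel (\<mu> + \<nu>) (t - r) * F r \<partial>lborel)"
proof -
  define H where "H = (\<lambda>r s. RL_kernel \<mu> (t - s) * RL_kernel \<nu> (s - r) * F r)"
  have mH: "case_prod H \<in> borel_measurable (lborel \<Otimes>\<^sub>M lborel)"
    unfolding H_def by measurable
  note conv = RL_kernel_convolution_shift[OF pos, of t, unfolded has_bochner_integral_iff]
  have "integrable (lborel \<Otimes>\<^sub>M lborel) (case_prod H)"
  proof (rule lborel_pair.Fubini_integrable[OF mH])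
    have "(\<integral>s. norm (H r s) \<partial>lborel) = RL_kernel (\<mu> + \<nu>) (t - r) * \<bar>F r\<bar>" for r
    proof -
      have "norm (H r s) = RL_kernel \<mu> (t - s) * RL_kernel \<nu> (s - r) * \<bar>F r\<bar>" for s
        using pos by (simp add: H_def abs_mult RL_kernel_nonneg)
      then show ?thesis using conv[of r] by simp
    qed
    moreover have "integrable lborel (\<lambda>r. RL_kernel (\<mu> + \<nu>) (t - r) * \<bar>F r\<bar>)"
      by (rule RL_kernel_integrable[where C=C and a=a]) (use pos bdd left in auto)
    ultimately show "integrable lborel (\<lambda>r. \<integral>s. norm (case_prod H (r, s)) \<partial>lborel)" by simp
    show "AE r in lborel. integrable lborel (\<lambda>s. case_prod H (r, s))"
      using conv by (auto simp: H_def)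
  qed
  note I = lborel_pair.integrable_snd[OF this] lborel_pair.Fubini_integral[OF this]
  have "(\<integral>r. H r s \<partial>lborel) = RL_kernel \<mu> (t - s) * (\<integral>r. RL_kernel \<nu> (s - r) * F r \<partial>lborel)" for s
    by (simp add: H_def mult.assoc)
  moreover have "(\<integral>s. H r s \<partial>lborel) = RL_kernel (\<mu> + \<nu>) (t - r) * F r" for r
    using conv[of r] by (simp add: H_def)
  ultimately show ?thesis using I by (simp add: has_bochner_integral_iff)
qed

section \<open>Riemann-Liouville integrals of continuous functions\<close>

text \<open>Passes from the gauge integral that defines \<open>RL_integral\<close> to the Lebesgue integral, where Fubini's
  theorem is available. As \<open>t \<le> b\<close>, cutting off to \<open>[a,b]\<close> and the support of the kernel leave \<open>[a,t]\<close>.\<close>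

lemma RL_integral_eq_lebesgue:
  assumes "0 < \<nu>" "t \<le> b"
    and int: "integrable lborel (\<lambda>s. RL_kernel \<nu> (t - s) * (indicator {a..b} s * f s))"
  shows "(\<lambda>s. (t - s) powr (\<nu> - 1) * f s) integrable_on {a..t}"
    and "RL_integral a \<nu> f t = (\<integral>s. RL_kernel \<nu> (t - s) * (indicator {a..b} s * f s) \<partial>lborel)"
proof -
  let ?I = "\<integral>s. RL_kernel \<nu> (t - s) * (indicator {a..b} s * f s) \<partial>lborel"
  note G = Gamma_real_pos[OF assms(1)]
  have "(\<lambda>s. RL_kernel \<nu> (t - s) * (indicator {a..b} s * f s))
      = (\<lambda>s. if s \<in> {a..t} then 1 / Gamma \<nu> * ((t - s) powr (\<nu> - 1) * f s) else 0)"
    using assms(2) by (auto simp: fun_eq_iff RL_kernel_def indicator_def)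
  with has_integral_integral_lborel[OF int]
  have "((\<lambda>s. 1 / Gamma \<nu> * ((t - s) powr (\<nu> - 1) * f s)) has_integral ?I) {a..t}"
    by (simp only: has_integral_restrict_UNIV)
  from has_integral_mult_right[OF this, of "Gamma \<nu>"] G
  have *: "((\<lambda>s. (t - s) powr (\<nu> - 1) * f s) has_integral Gamma \<nu> * ?I) {a..t}" by simp
  then show "(\<lambda>s. (t - s) powr (\<nu> - 1) * f s) integrable_on {a..t}" by blast
  have "Gamma \<nu> \<noteq> 0" using G by linarith
  then show "RL_integral a \<nu> f t = ?I"
    using integral_unique[OF *] assms(1) by (simp add: RL_integral_def)
qed

lemma continuous_cutoff:
  fixes f :: "real \<Rightarrow> real"
  assumes "continuous_on {a..b} f"
  obtains C where "(\<lambda>s. indicator {a..b} s * f s) \<in> borel_measurable borel"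
    and "\<And>s. \<bar>indicator {a..b} s * f s\<bar> \<le> C"
proof -
  have "bounded (f ` {a..b})"
    using assms compact_continuous_image compact_imp_bounded by blast
  then obtain C where "\<And>s. s \<in> {a..b} \<Longrightarrow> \<bar>f s\<bar> \<le> C"
    unfolding bounded_iff by (metis imageI real_norm_def)
  then have "\<bar>indicator {a..b} s * f s\<bar> \<le> max C 0" for s
    by (auto simp: indicator_def le_max_iff_disj)
  moreover have "(\<lambda>s. indicator {a..b} s * f s) \<in> borel_measurable borel"
    using borel_measurable_continuous_on_indicator[OF _ assms] by simp
  ultimately show ?thesis using that by blast
qed

lemma RL_integral_continuous:
  assumes "continuous_on {a..b} f" "0 < \<nu>" "t \<le> b"
  shows "(\<lambda>s. (t - s) powr (\<nu> - 1) * f s) integrable_on {a..t}"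
    and "RL_integral a \<nu> f t = (\<integral>s. RL_kernel \<nu> (t - s) * (indicator {a..b} s * f s) \<partial>lborel)"
proof -
  obtain C where C: "(\<lambda>s. indicator {a..b} s * f s) \<in> borel_measurable borel"
    "\<And>s. \<bar>indicator {a..b} s * f s\<bar> \<le> C" using continuous_cutoff[OF assms(1)] by blast
  note int = RL_kernel_integrable[OF assms(2) C, of a]
  show "(\<lambda>s. (t - s) powr (\<nu> - 1) * f s) integrable_on {a..t}"
    by (rule RL_integral_eq_lebesgue(1)[OF assms(2,3) int]) simp
  show "RL_integral a \<nu> f t = (\<integral>s. RL_kernel \<nu> (t - s) * (indicator {a..b} s * f s) \<partial>lborel)"
    by (rule RL_integral_eq_lebesgue(2)[OF assms(2,3) int]) simp
qed

lemma RL_integral_cong: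
  assumes "a \<le> t" "\<And>s. s \<in> {a..t} \<Longrightarrow> f s = g s"
  shows "RL_integral a \<nu> f t = RL_integral a \<nu> g t"
proof -
  have "integral {a..t} (\<lambda>s. (t - s) powr (\<nu> - 1) * f s) = integral {a..t} (\<lambda>s. (t - s) powr (\<nu> - 1) * g s)"
    by (rule integral_cong) (simp add: assms)
  then show ?thesis using assms by (simp add: RL_integral_def)
qed

text \<open>The integrability of \<open>I\<^sup>\<nu> f\<close>, a by-product of Fubini's theorem, holds even where \<open>\<nu> < 1\<close>; it is what
  makes the indefinite integral of \<open>I\<^sup>\<nu> f\<close> continuous.\<close>

lemma RL_integral_semigroup_pos:
  assumes f: "continuous_on {a..b} f" and pos: "0 < \<mu>" "0 < \<nu>" and t: "t \<le> b"
  shows "(\<lambda>s. (t - s) powr (\<mu> - 1) * RL_integral a \<nu> f s) integrable_on {a..t}"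
    and "RL_integral a \<mu> (RL_integral a \<nu> f) t = RL_integral a (\<mu> + \<nu>) f t"
proof -
  obtain C where C: "(\<lambda>s. indicator {a..b} s * f s) \<in> borel_measurable borel"
    "\<And>s. \<bar>indicator {a..b} s * f s\<bar> \<le> C" using continuous_cutoff[OF f] by blast
  let ?J = "\<lambda>s. \<integral>r. RL_kernel \<nu> (s - r) * (indicator {a..b} r * f r) \<partial>lborel"
  have z: "?J s = 0" if "s < a" for s
  proof -
    have "RL_kernel \<nu> (s - r) * (indicator {a..b} r * f r) = 0" for r
      using that by (auto simp: RL_kernel_def indicator_def)
    then show ?thesis by (intro integral_eq_zero_AE AE_I2) auto
  qed
  have "RL_kernel \<mu> (t - s) * ?J s = RL_kernel \<mu> (t - s) * (indicator {a..b} s * RL_integral a \<nu> f s)" for s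
  proof (cases "s \<in> {a..b}")
    case True
    then show ?thesis using RL_integral_continuous(2)[OF f pos(2), of s] by simp
  next
    case False
    then show ?thesis using z[of s] t by (auto simp: RL_kernel_def)
  qed
  with RL_kernel_iterated[OF pos C, of a t]
  have H: "has_bochner_integral lborel (\<lambda>s. RL_kernel \<mu> (t - s) * (indicator {a..b} s * RL_integral a \<nu> f s))
      (\<integral>r. RL_kernel (\<mu> + \<nu>) (t - r) * (indicator {a..b} r * f r) \<partial>lborel)"
    by simp
  then have int: "integrable lborel (\<lambda>s. RL_kernel \<mu> (t - s) * (indicator {a..b} s * RL_integral a \<nu> f s))"
    by (simp add: has_bochner_integral_iff)
  show "(\<lambda>s. (t - s) powr (\<mu> - 1) * RL_integral a \<nu> f s) integrable_on {a..t}"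
    by (rule RL_integral_eq_lebesgue(1)[OF pos(1) t int])
  show "RL_integral a \<mu> (RL_integral a \<nu> f) t = RL_integral a (\<mu> + \<nu>) f t"
    unfolding RL_integral_eq_lebesgue(2)[OF pos(1) t int]
    using H RL_integral_continuous(2)[OF f _ t, of "\<mu> + \<nu>"] pos by (simp add: has_bochner_integral_iff)
qed

lemma RL_integral_semigroup:
  assumes "continuous_on {a..b} f" "0 \<le> \<mu>" "0 \<le> \<nu>" "t \<in> {a..b}"
  shows "RL_integral a \<mu> (RL_integral a \<nu> f) t = RL_integral a (\<mu> + \<nu>) f t"
proof (cases "\<mu> = 0 \<or> \<nu> = 0")
  case True
  have "RL_integral a 0 g = g" for g by (simp add: RL_integral_def fun_eq_iff)
  then show ?thesis using True by auto
next
  case False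
  then show ?thesis using RL_integral_semigroup_pos(2)[OF assms(1), of \<mu> \<nu> t] assms by auto
qed

lemma RL_integral_one: "RL_integral a 1 f t = integral {a..t} f"
proof -
  have "integral {a..t} (\<lambda>s. (t - s) powr (1 - 1) * f s) = integral {a..t} f"
    by (rule integral_spike[of "{t}"]) auto
  then show ?thesis by (simp add: RL_integral_def)
qed

text \<open>For \<open>\<nu> \<ge> 1\<close> the function \<open>I\<^sup>\<nu> f\<close> is an indefinite integral, namely of \<open>I\<^bsup>\<nu> - 1\<^esup> f\<close>.\<close>

lemma RL_integral_continuous_on:
  assumes f: "continuous_on {a..b} f" and "1 \<le> \<nu>"
  shows "continuous_on {a..b} (RL_integral a \<nu> f)"
proof (cases "\<nu> = 1")
  case True
  then show ?thesis
    using indefinite_integral_continuous_1[OF integrable_continuous_real[OF f]]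
    by (simp add: RL_integral_one[abs_def])
next
  case False
  then have pos: "0 < \<nu> - 1" using assms by simp
  have "(\<lambda>s. (b - s) powr (1 - 1) * RL_integral a (\<nu> - 1) f s) integrable_on {a..b}"
    by (rule RL_integral_semigroup_pos(1)[OF f _ pos]) auto
  then have "RL_integral a (\<nu> - 1) f integrable_on {a..b}"
    by (rule integrable_spike[of _ _ "{b}"]) auto
  then have "continuous_on {a..b} (\<lambda>t. integral {a..t} (RL_integral a (\<nu> - 1) f))"
    by (rule indefinite_integral_continuous_1)
  moreover have "integral {a..t} (RL_integral a (\<nu> - 1) f) = RL_integral a \<nu> f t" if "t \<in> {a..b}" for t
    using RL_integral_semigroup_pos(2)[OF f _ pos, of 1 t] that by (simp add: RL_integral_one)
  ultimately show ?thesis using continuous_on_eq by blast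
qed

lemma RL_integral_diff:
  assumes "continuous_on {a..b} f" "continuous_on {a..b} g" "0 \<le> \<nu>" "t \<in> {a..b}"
  shows "RL_integral a \<nu> (\<lambda>s. c * f s - g s) t = c * RL_integral a \<nu> f t - RL_integral a \<nu> g t"
proof (cases "\<nu> = 0")
  case True
  then show ?thesis by (simp add: RL_integral_def)
next
  case False
  with assms have pos: "0 < \<nu>" "t \<le> b" by auto
  note i = RL_integral_continuous(1)[OF assms(1) pos] RL_integral_continuous(1)[OF assms(2) pos]
  have "integral {a..t} (\<lambda>s. (t - s) powr (\<nu> - 1) * (c * f s - g s))
     = integral {a..t} (\<lambda>s. c * ((t - s) powr (\<nu> - 1) * f s) - (t - s) powr (\<nu> - 1) * g s)"
    by (simp add: algebra_simps)
  also have "\<dots> = integral {a..t} (\<lambda>s. c * ((t - s) powr (\<nu> - 1) * f s)) - integral {a..t} (\<lambda>s. (t - s) powr (\<nu> - 1) * g s)"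
    by (intro Henstock_Kurzweil_Integration.integral_diff integrable_on_mult_right i)
  finally show ?thesis using pos by (simp add: RL_integral_def right_diff_distrib)
qed

lemma RL_integral_const:
  assumes "0 \<le> \<nu>" "a < t"
  shows "RL_integral a \<nu> (\<lambda>_. 1) t = (t - a) powr \<nu> / Gamma (\<nu> + 1)"
proof (cases "\<nu> = 0")
  case True
  then show ?thesis using assms by (simp add: RL_integral_def)
next
  case False
  with assms have pos: "0 < \<nu>" by simp
  have "((\<lambda>s. (t - s) powr (\<nu> - 1)) has_integral (- ((t - t) powr \<nu> / \<nu>) - - ((t - a) powr \<nu> / \<nu>))) {a..t}"
  proof (rule fundamental_theorem_of_calculus_interior)
    show "continuous_on {a..t} (\<lambda>s. - ((t - s) powr \<nu> / \<nu>))"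
      using pos by (intro continuous_intros continuous_on_powr') auto
    fix s assume "s \<in> {a<..<t}"
    then have "((\<lambda>s. - ((t - s) powr \<nu> / \<nu>)) has_real_derivative (t - s) powr (\<nu> - 1)) (at s)"
      using pos by (auto intro!: derivative_eq_intros simp: powr_diff field_simps)
    then show "((\<lambda>s. - ((t - s) powr \<nu> / \<nu>)) has_vector_derivative (t - s) powr (\<nu> - 1)) (at s)"
      by (simp add: has_real_derivative_iff_has_vector_derivative)
  qed (use assms in auto)
  then have "integral {a..t} (\<lambda>s. (t - s) powr (\<nu> - 1)) = (t - a) powr \<nu> / \<nu>"
    by (simp add: integral_unique)
  moreover have "Gamma (\<nu> + 1) = \<nu> * Gamma \<nu>" by (rule Gamma_plus1) (use pos in \<open>auto elim!: nonpos_Ints_cases\<close>)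
  ultimately show ?thesis using pos by (simp add: RL_integral_def)
qed

text \<open>The order 0 is separate because the closed formula has the wrong value \<open>0 powr 0 = 0\<close> at \<open>a\<close>.\<close>

lemma RL_integral_const_continuous_on:
  assumes "0 \<le> \<nu>"
  shows "continuous_on {a..b} (RL_integral a \<nu> (\<lambda>_. 1))"
proof (cases "\<nu> = 0")
  case True
  then show ?thesis by (simp add: RL_integral_def[abs_def])
next
  case False
  have "RL_integral a \<nu> (\<lambda>_. 1) t = (t - a) powr \<nu> / Gamma (\<nu> + 1)" if "t \<in> {a..b}" for t
  proof (cases "t = a")
    case True
    then show ?thesis using False by (simp add: RL_integral_def)
  next
    case ne: False
    then show ?thesis using that assms by (intro RL_integral_const) auto
  qed
  moreover have "Gamma (\<nu> + 1) \<noteq> 0" using Gamma_real_pos[of "\<nu> + 1"] assms by linarith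
  then have "continuous_on {a..b} (\<lambda>t. (t - a) powr \<nu> / Gamma (\<nu> + 1))"
    using assms False by (intro continuous_intros continuous_on_powr') auto
  ultimately show ?thesis by (metis (no_types, lifting) continuous_on_eq)
qed

lemma RL_integral_one_has_derivative:
  assumes "continuous_on {a..b} f" "t \<in> {a..b}"
  shows "(RL_integral a 1 f has_real_derivative f t) (at t within {a..b})"
  using integral_has_real_derivative[OF assms] by (simp add: RL_integral_one[abs_def])

lemma real_derivative_unique_Icc:
  fixes f :: "real \<Rightarrow> real"
  assumes "a < b" "t \<in> {a..b}"
    and "(f has_real_derivative y) (at t within {a..b})"
    and "(f has_real_derivative z) (at t within {a..b})"
  shows "y = z"
  using vector_derivative_unique_within_closed_interval[of a b t f y z] assms
  by (simp add: has_real_derivative_iff_has_vector_derivative)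

lemma RL_integral_one_inject:
  assumes "a < b" "continuous_on {a..b} f" "continuous_on {a..b} g"
    and eq: "\<And>t. t \<in> {a..b} \<Longrightarrow> RL_integral a 1 f t = RL_integral a 1 g t"
    and t: "t \<in> {a..b}"
  shows "f t = g t"
proof (rule real_derivative_unique_Icc[OF assms(1) t])
  show "(RL_integral a 1 f has_real_derivative f t) (at t within {a..b})"
    by (rule RL_integral_one_has_derivative[OF assms(2) t])
  show "(RL_integral a 1 f has_real_derivative g t) (at t within {a..b})"
    by (rule has_field_derivative_transform_within[OF RL_integral_one_has_derivative[OF assms(3) t] zero_less_one t])
       (simp add: eq)
qed

section \<open>Inverting the fractional derivative\<close>

lemma has_nth_derivative_within_1:
  assumes "has_nth_derivative_within (Suc 0) f y x S"
  shows "(f has_real_derivative y) (at x within S)"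
proof -
  obtain g where g: "f x = g x" "\<forall>\<^sub>F t in at x within S. f t = g t"
      "(g has_real_derivative y) (at x within S)"
    using assms by auto
  then show ?thesis
    by (subst has_field_derivative_cong_eventually[OF g(2,1)])
qed

text \<open>The intermediate derivative in the recursive definition may depend on the point; uniqueness of
  derivatives on a nondegenerate interval glues the local choices into one function.\<close>

lemma has_nth_derivative_within_2_Icc:
  assumes "a < b"
    and D: "\<And>t. t \<in> {a..b} \<Longrightarrow> has_nth_derivative_within (Suc (Suc 0)) f (y t) t {a..b}"
  obtains k where "\<And>t. t \<in> {a..b} \<Longrightarrow> (f has_real_derivative k t) (at t within {a..b})"
    and "\<And>t. t \<in> {a..b} \<Longrightarrow> (k has_real_derivative y t) (at t within {a..b})"
proof -
  define k where "k t = (SOME d. (f has_real_derivative d) (at t within {a..b}))" for t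
  have ex: "\<exists>g. (f has_real_derivative g t) (at t within {a..b}) \<and>
      (\<forall>\<^sub>F s in at t within {a..b}. (f has_real_derivative g s) (at s within {a..b})) \<and>
      (g has_real_derivative y t) (at t within {a..b})" if "t \<in> {a..b}" for t
    using D[OF that] has_nth_derivative_within_1 unfolding has_nth_derivative_within.simps(2)[of "Suc 0"]
    by (smt (verit, ccfv_threshold) eventually_mono)
  have k: "(f has_real_derivative k t) (at t within {a..b})" if "t \<in> {a..b}" for t
    unfolding k_def using ex[OF that] someI_ex[of "\<lambda>d. (f has_real_derivative d) (at t within {a..b})"] by blast
  moreover have "(k has_real_derivative y t) (at t within {a..b})" if t: "t \<in> {a..b}" for t
  proof -
    obtain g where g: "(f has_real_derivative g t) (at t within {a..b})"
      "\<forall>\<^sub>F s in at t within {a..b}. (f has_real_derivative g s) (at s within {a..b})"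
      "(g has_real_derivative y t) (at t within {a..b})" using ex[OF t] by blast
    have "\<forall>\<^sub>F s in at t within {a..b}. s \<in> {a..b}" by (auto simp: eventually_at_filter)
    with g(2) have "\<forall>\<^sub>F s in at t within {a..b}. k s = g s"
      by eventually_elim (metis real_derivative_unique_Icc[OF assms(1)] k)
    moreover have "k t = g t" using real_derivative_unique_Icc[OF assms(1) t k[OF t] g(1)] .
    ultimately show ?thesis using g(3) by (subst has_field_derivative_cong_eventually)
  qed
  ultimately show ?thesis using that by blast
qed

text \<open>The only free constant left is \<open>c = w'(a)\<close>, as \<open>w = I\<^bsup>2 - \<alpha>\<^esup> u\<close> vanishes at \<open>a\<close>: for \<open>\<alpha> < 2\<close>
  it is an integral over a single point, and for \<open>\<alpha> = 2\<close> it is \<open>u\<close> itself.\<close>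

lemma RL_derivative_inversion:
  assumes "a < b" "1 < \<alpha>" "\<alpha> \<le> 2" and u: "continuous_on {a..b} u" "u a = 0"
    and h: "continuous_on {a..b} h"
    and D: "\<And>t. t \<in> {a..b} \<Longrightarrow> has_RL_derivative a b \<alpha> u (- h t) t"
  obtains c where "\<And>t. t \<in> {a..b} \<Longrightarrow>
    u t = c * RL_integral a (\<alpha> - 1) (\<lambda>_. 1) t - RL_integral a \<alpha> h t"
proof -
  let ?w = "RL_integral a (2 - \<alpha>) u"
  let ?p = "RL_integral a (\<alpha> - 1) (\<lambda>_. 1)"
  let ?Ih = "RL_integral a \<alpha> h"
  have n: "nat \<lceil>\<alpha>\<rceil> = Suc (Suc 0)"
  proof -
    have "\<lceil>\<alpha>\<rceil> = 2" by (rule ceiling_unique) (use assms in auto)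
    then show ?thesis by simp
  qed
  obtain k where k: "\<And>t. t \<in> {a..b} \<Longrightarrow> (?w has_real_derivative k t) (at t within {a..b})"
    "\<And>t. t \<in> {a..b} \<Longrightarrow> (k has_real_derivative - h t) (at t within {a..b})"
    using has_nth_derivative_within_2_Icc[OF assms(1), of ?w "\<lambda>t. - h t"] D
    unfolding has_RL_derivative_def n by (auto simp: Let_def)
  have ck: "continuous_on {a..b} k"
    using k(2) by (meson DERIV_continuous_on)
  have FTC: "F t - F a = integral {a..t} f"
    if F: "\<And>t. t \<in> {a..b} \<Longrightarrow> (F has_real_derivative f t) (at t within {a..b})" and t: "t \<in> {a..b}" for F f t
  proof -
    have "(f has_integral F t - F a) {a..t}"
      using t by (intro fundamental_theorem_of_calculus)
        (auto simp: has_real_derivative_iff_has_vector_derivative[symmetric] intro: DERIV_subset[OF F])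
    then show ?thesis by (simp add: integral_unique)
  qed
  have k_eq: "k t = k a * 1 - RL_integral a 1 h t" if "t \<in> {a..b}" for t
    using FTC[OF k(2) that] by (simp add: RL_integral_one)
  have "?w a = 0" using u by (simp add: RL_integral_def)
  then have w_eq: "?w t = RL_integral a 1 k t" if "t \<in> {a..b}" for t
    using FTC[OF k(1) that] by (simp add: RL_integral_one)
  have c1: "continuous_on {a..b} (\<lambda>_. 1::real)" by simp
  have cp: "continuous_on {a..b} ?p" using assms by (intro RL_integral_const_continuous_on) auto
  have ch: "continuous_on {a..b} ?Ih" using assms by (intro RL_integral_continuous_on) auto
  have c1h: "continuous_on {a..b} (RL_integral a 1 h)" using h by (intro RL_integral_continuous_on) auto
  \<comment> \<open>Both sides are brought to the form \<open>I v\<close> with continuous \<open>v\<close>, so that one ordinary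
    differentiation removes the integral.\<close>
  have eq: "RL_integral a 1 u t = RL_integral a 1 (\<lambda>t. k a * ?p t - ?Ih t) t" if t: "t \<in> {a..b}" for t
  proof -
    have "RL_integral a 1 u t = RL_integral a (\<alpha> - 1) ?w t"
      using RL_integral_semigroup[OF u(1) _ _ t, of "\<alpha> - 1" "2 - \<alpha>"] assms by simp
    also have "\<dots> = RL_integral a (\<alpha> - 1) (RL_integral a 1 k) t"
      by (rule RL_integral_cong) (use t w_eq in auto)
    also have "\<dots> = RL_integral a \<alpha> k t"
      using RL_integral_semigroup[OF ck _ _ t, of "\<alpha> - 1" 1] assms by simp
    also have "\<dots> = RL_integral a \<alpha> (\<lambda>s. k a * 1 - RL_integral a 1 h s) t"
    proof (rule RL_integral_cong)
      show "a \<le> t" using t by simp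
      show "k s = k a * 1 - RL_integral a 1 h s" if "s \<in> {a..t}" for s
        by (rule k_eq) (use that t in auto)
    qed
    also have "\<dots> = k a * RL_integral a \<alpha> (\<lambda>_. 1) t - RL_integral a \<alpha> (RL_integral a 1 h) t"
      by (rule RL_integral_diff[OF c1 c1h _ t]) (use assms in auto)
    also have "RL_integral a \<alpha> (\<lambda>_. 1) t = RL_integral a 1 ?p t"
      using RL_integral_semigroup[OF c1 _ _ t, of 1 "\<alpha> - 1"] assms by simp
    also have "RL_integral a \<alpha> (RL_integral a 1 h) t = RL_integral a 1 ?Ih t"
      using RL_integral_semigroup[OF h _ _ t, of \<alpha> 1] RL_integral_semigroup[OF h _ _ t, of 1 \<alpha>] assms
      by (simp add: add.commute)
    also have "k a * RL_integral a 1 ?p t - RL_integral a 1 ?Ih t = RL_integral a 1 (\<lambda>t. k a * ?p t - ?Ih t) t"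
      using RL_integral_diff[OF cp ch _ t, of 1] by simp
    finally show ?thesis .
  qed
  have cv: "continuous_on {a..b} (\<lambda>t. k a * ?p t - ?Ih t)"
    by (intro continuous_intros cp ch)
  have "u t = k a * ?p t - ?Ih t" if "t \<in> {a..b}" for t
    using RL_integral_one_inject[OF assms(1) u(1) cv eq that] .
  then show ?thesis using that by blast
qed

text \<open>For \<open>\<beta> > 0\<close>, the semigroup law writes \<open>I\<^bsup>1 - \<beta>\<^esup> u\<close> as the ordinary integral of the continuous
  function \<open>c I\<^bsup>\<alpha> - 1 - \<beta>\<^esup> 1 - I\<^bsup>\<alpha> - \<beta>\<^esup> h\<close>, whose value at \<open>b\<close> is therefore \<open>D\<^sup>\<beta> u(b)\<close>.\<close>

lemma RL_derivative_boundary_value: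
  assumes "a < b" "1 < \<alpha>" "\<alpha> \<le> 2" "0 \<le> \<beta>" "\<beta> \<le> \<alpha> - 1" and h: "continuous_on {a..b} h"
    and u: "\<And>t. t \<in> {a..b} \<Longrightarrow>
      u t = c * RL_integral a (\<alpha> - 1) (\<lambda>_. 1) t - RL_integral a \<alpha> h t"
    and D: "has_RL_derivative a b \<beta> u 0 b"
  shows "c * RL_integral a (\<alpha> - 1 - \<beta>) (\<lambda>_. 1) b = RL_integral a (\<alpha> - \<beta>) h b"
proof (cases "\<beta> = 0")
  case True
  then have "u b = 0" using D by (simp add: has_RL_derivative_def RL_integral_def)
  then show ?thesis using u[of b] True assms(1) by simp
next
  case False
  let ?w = "RL_integral a (1 - \<beta>) u"
  let ?p = "RL_integral a (\<alpha> - 1 - \<beta>) (\<lambda>_. 1)"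
  let ?Ih = "RL_integral a (\<alpha> - \<beta>) h"
  have n: "nat \<lceil>\<beta>\<rceil> = Suc 0"
  proof -
    have "\<lceil>\<beta>\<rceil> = 1" by (rule ceiling_unique) (use assms False in auto)
    then show ?thesis by simp
  qed
  have b: "b \<in> {a..b}" using assms by simp
  have D0: "(?w has_real_derivative 0) (at b within {a..b})"
    using D has_nth_derivative_within_1 unfolding has_RL_derivative_def n Let_def by fastforce
  have c1: "continuous_on {a..b} (\<lambda>_. 1::real)" by simp
  have cp: "continuous_on {a..b} ?p" using assms by (intro RL_integral_const_continuous_on) auto
  have ch: "continuous_on {a..b} ?Ih" using assms by (intro RL_integral_continuous_on) auto
  have cp': "continuous_on {a..b} (RL_integral a (\<alpha> - 1) (\<lambda>_. 1))"
    using assms by (intro RL_integral_const_continuous_on) auto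
  have ch': "continuous_on {a..b} (RL_integral a \<alpha> h)" using assms by (intro RL_integral_continuous_on) auto
  have w: "?w t = RL_integral a 1 (\<lambda>t. c * ?p t - ?Ih t) t" if t: "t \<in> {a..b}" for t
  proof -
    have "?w t = RL_integral a (1 - \<beta>) (\<lambda>t. c * RL_integral a (\<alpha> - 1) (\<lambda>_. 1) t - RL_integral a \<alpha> h t) t"
      by (rule RL_integral_cong) (use t u in auto)
    also have "\<dots> = c * RL_integral a (1 - \<beta>) (RL_integral a (\<alpha> - 1) (\<lambda>_. 1)) t
        - RL_integral a (1 - \<beta>) (RL_integral a \<alpha> h) t"
      by (rule RL_integral_diff[OF cp' ch' _ t]) (use assms in auto)
    also have "RL_integral a (1 - \<beta>) (RL_integral a (\<alpha> - 1) (\<lambda>_. 1)) t = RL_integral a 1 ?p t"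
      using RL_integral_semigroup[OF c1 _ _ t, of "1 - \<beta>" "\<alpha> - 1"]
        RL_integral_semigroup[OF c1 _ _ t, of 1 "\<alpha> - 1 - \<beta>"] assms by simp
    also have "RL_integral a (1 - \<beta>) (RL_integral a \<alpha> h) t = RL_integral a 1 ?Ih t"
      using RL_integral_semigroup[OF h _ _ t, of "1 - \<beta>" \<alpha>]
        RL_integral_semigroup[OF h _ _ t, of 1 "\<alpha> - \<beta>"] assms by (simp add: algebra_simps)
    also have "c * RL_integral a 1 ?p t - RL_integral a 1 ?Ih t = RL_integral a 1 (\<lambda>t. c * ?p t - ?Ih t) t"
      using RL_integral_diff[OF cp ch _ t, of 1] by simp
    finally show ?thesis .
  qed
  have cv: "continuous_on {a..b} (\<lambda>t. c * ?p t - ?Ih t)"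
    by (intro continuous_intros cp ch)
  have "(?w has_real_derivative c * ?p b - ?Ih b) (at b within {a..b})"
    by (rule has_field_derivative_transform_within[OF RL_integral_one_has_derivative[OF cv b] zero_less_one b])
       (simp add: w)
  then have "0 = c * ?p b - ?Ih b" by (rule real_derivative_unique_Icc[OF assms(1) b D0])
  then show ?thesis by simp
qed

section \<open>The Green function and its bounds\<close>

text \<open>The case distinction makes the weight the constant 1 for \<open>r = 0\<close>, also at \<open>s = b\<close>, where
  \<open>0 powr 0 = 0\<close>; otherwise it would be discontinuous there.\<close>

definition green_weight :: "real \<Rightarrow> real \<Rightarrow> real \<Rightarrow> real \<Rightarrow> real" where
  "green_weight a b r s = (if r = 0 then 1 else ((b - s) / (b - a)) powr r)"

lemma green_weight_continuous_on: "a < b \<Longrightarrow> 0 \<le> r \<Longrightarrow> continuous_on {a..b} (green_weight a b r)"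
proof (cases "r = 0")
  case True
  then show ?thesis by (simp add: green_weight_def[abs_def])
next
  case False
  assume "a < b" "0 \<le> r"
  then show ?thesis unfolding green_weight_def[abs_def] using False
    by (simp, intro continuous_on_powr' continuous_intros) auto
qed

lemma green_weight_bounds:
  assumes "a < b" "0 \<le> r" "s \<in> {a..b}"
  shows "0 \<le> green_weight a b r s" "green_weight a b r s \<le> 1"
  using assms by (auto simp: green_weight_def intro!: powr_le1)

text \<open>This is \<open>\<Gamma>(\<alpha>)\<close> times the Green function of \<open>- D\<^sup>\<alpha>\<close> with the boundary conditions \<open>u(a) = 0\<close> and
  \<open>D\<^sup>\<beta> u(b) = 0\<close>, for \<open>p = \<alpha> - 1\<close> and \<open>r = \<alpha> - 1 - \<beta>\<close>. The truncation \<open>max 0 (t - s)\<close> gives both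
  branches in one formula, continuous in \<open>s\<close> as \<open>p > 0\<close>.\<close>

definition green :: "real \<Rightarrow> real \<Rightarrow> real \<Rightarrow> real \<Rightarrow> real \<Rightarrow> real \<Rightarrow> real" where
  "green a b p r t s = (t - a) powr p * green_weight a b r s - (max 0 (t - s)) powr p"

lemma green_continuous_on:
  assumes "a < b" "0 < p" "0 \<le> r"
  shows "continuous_on {a..b} (green a b p r t)"
  unfolding green_def[abs_def] using assms
  by (intro continuous_intros green_weight_continuous_on continuous_on_powr') auto

lemma powr_add_le:
  fixes x y p :: real
  assumes "0 \<le> x" "0 \<le> y" "0 < p" "p \<le> 1"
  shows "(x + y) powr p \<le> x powr p + y powr p"
proof (cases "x + y = 0")
  case True
  then show ?thesis using assms by simp
next
  case False
  then have pos: "0 < x + y" using assms by linarith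
  have "x / (x + y) + y / (x + y) = 1" using pos by (simp add: add_divide_distrib[symmetric])
  moreover have "x / (x + y) \<le> (x / (x + y)) powr p" "y / (x + y) \<le> (y / (x + y)) powr p"
    using powr_mono'[of p 1 "x / (x + y)"] powr_mono'[of p 1 "y / (x + y)"] assms pos
    by (auto simp: divide_le_eq)
  ultimately have "1 \<le> (x powr p + y powr p) / (x + y) powr p"
    using assms pos by (simp add: powr_divide add_divide_distrib)
  then show ?thesis using pos by (simp add: le_divide_eq)
qed

text \<open>For \<open>s < t\<close>, divide by \<open>(t - a)\<^sup>p\<close>: the ratio \<open>(t - s) / (t - a)\<close> increases with \<open>t\<close> and reaches
  \<open>(b - s) / (b - a) \<le> 1\<close> at \<open>t = b\<close>, and lowering the exponent of a number in \<open>[0,1]\<close> from \<open>p\<close> to \<open>r\<close>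
  makes it larger.\<close>

lemma green_nonneg:
  assumes "a < b" "0 < p" "0 \<le> r" "r \<le> p" "t \<in> {a..b}" "s \<in> {a..b}"
  shows "0 \<le> green a b p r t s"
proof (cases "s < t")
  case False
  then show ?thesis using assms green_weight_bounds[of a b r s] by (simp add: green_def)
next
  case True
  then have ta: "0 < t - a" using assms by auto
  have "(t - s) / (t - a) \<le> (b - s) / (b - a)"
  proof -
    have "0 \<le> (b - t) * (s - a)" using assms by simp
    then show ?thesis using assms(1) ta by (simp add: field_simps)
  qed
  then have "((t - s) / (t - a)) powr p \<le> ((b - s) / (b - a)) powr p"
    using assms True ta by (intro powr_mono2) auto
  also have "\<dots> \<le> green_weight a b r s"
  proof (cases "r = 0")
    case r: True
    then show ?thesis using assms by (auto simp: green_weight_def intro!: powr_le1)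
  next
    case False
    then show ?thesis using assms by (auto simp: green_weight_def intro!: powr_mono')
  qed
  finally have "(t - s) powr p / (t - a) powr p \<le> green_weight a b r s"
    using True ta by (simp add: powr_divide)
  then show ?thesis using True ta by (simp add: green_def divide_le_eq mult.commute)
qed

text \<open>Off the diagonal, with \<open>s < t\<close>, this is subadditivity of \<open>x\<^sup>p\<close> for \<open>p \<le> 1\<close>: the increment of
  \<open>(t - a)\<^sup>p\<close> over \<open>(s - a)\<^sup>p\<close>, reduced by a weight at most 1, is absorbed by \<open>(t - s)\<^sup>p\<close>.\<close>

lemma green_le_diagonal:
  assumes "a < b" "0 < p" "p \<le> 1" "0 \<le> r" "t \<in> {a..b}" "s \<in> {a..b}"
  shows "green a b p r t s \<le> (s - a) powr p * green_weight a b r s"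
proof -
  note k = green_weight_bounds[OF assms(1,4,6)]
  show ?thesis
  proof (cases "s < t")
    case False
    then have "(t - a) powr p * green_weight a b r s \<le> (s - a) powr p * green_weight a b r s"
      using assms k by (intro mult_right_mono powr_mono2) auto
    then show ?thesis using False by (simp add: green_def)
  next
    case True
    have "(t - a) powr p \<le> (s - a) powr p + (t - s) powr p"
      using powr_add_le[of "s - a" "t - s" p] assms True by simp
    then have "(t - a) powr p * green_weight a b r s \<le> ((s - a) powr p + (t - s) powr p) * green_weight a b r s"
      using k by (intro mult_right_mono) auto
    also have "(t - s) powr p * green_weight a b r s \<le> (t - s) powr p"
      using k by (simp add: mult_left_le)
    then have "((s - a) powr p + (t - s) powr p) * green_weight a b r s
        \<le> (s - a) powr p * green_weight a b r s + (t - s) powr p" by (simp add: distrib_right)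
    finally show ?thesis using True by (simp add: green_def)
  qed
qed

text \<open>A weighted AM-GM inequality: scale \<open>s - a\<close> and \<open>(b - s) / (b - a)\<close> to \<open>X\<close> and \<open>Y\<close> that are 1 at the
  maximiser. Then \<open>p X + r Y = p + r\<close>, and \<open>ln x \<le> x - 1\<close>, strict unless \<open>x = 1\<close>, gives
  \<open>p ln X + r ln Y < 0\<close>.\<close>

lemma diagonal_less_max:
  assumes "a < b" "0 < p" "0 \<le> r" "s \<in> {a..b}" "s \<noteq> a + (b - a) * p / (p + r)"
  shows "(s - a) powr p * green_weight a b r s
    < ((b - a) * p / (p + r)) powr p * (if r = 0 then 1 else (r / (p + r)) powr r)" (is "_ < ?M")
proof -
  have pr: "0 < p + r" using assms by simp
  have Mpos: "0 < ?M" using assms by auto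
  show ?thesis
  proof (cases "r = 0")
    case True
    with assms have "s < b" by auto
    then show ?thesis using assms True by (simp add: green_weight_def powr_less_mono2)
  next
    case False
    then have r: "0 < r" using assms by simp
    show ?thesis
    proof (cases "s = a \<or> s = b")
      case True
      then show ?thesis using Mpos False by (auto simp: green_weight_def)
    next
      case inner: False
      then have s: "a < s" "s < b" using assms by auto
      define X where "X = (s - a) / ((b - a) * p / (p + r))"
      define Y where "Y = ((b - s) / (b - a)) / (r / (p + r))"
      have XY: "0 < X" "0 < Y" using s assms(1,2) r pr by (auto simp: X_def Y_def)
      have X1: "X \<noteq> 1"
      proof
        assume "X = 1"
        then have "s - a = (b - a) * p / (p + r)" using assms pr by (simp add: X_def)
        then show False using assms(5) by simp
      qed
      have "p * X + r * Y = p + r"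
      proof -
        have "p * X = (s - a) * (p + r) / (b - a)" using assms pr by (simp add: X_def)
        moreover have "r * Y = (b - s) * (p + r) / (b - a)" using r by (simp add: Y_def)
        ultimately have "p * X + r * Y = ((s - a) + (b - s)) * (p + r) / (b - a)"
          by (simp only: add_divide_distrib[symmetric] distrib_right)
        then show ?thesis using assms(1) by simp
      qed
      moreover have "ln X < X - 1"
        using ln_le_minus_one[of X] ln_eq_minus_one[of X] XY X1 by fastforce
      then have "p * ln X < p * (X - 1)" using assms by simp
      moreover have "r * ln Y \<le> r * (Y - 1)" using ln_le_minus_one[of Y] XY r by simp
      ultimately have "p * ln X + r * ln Y < 0" by (simp add: algebra_simps)
      then have "X powr p * Y powr r < 1" using XY by (simp add: powr_def exp_add[symmetric])
      moreover have "X powr p = (s - a) powr p / ((b - a) * p / (p + r)) powr p"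
        unfolding X_def using s assms(1,2) pr by (intro powr_divide)
      moreover have "Y powr r = ((b - s) / (b - a)) powr r / (r / (p + r)) powr r"
        unfolding Y_def using s assms(1,2) pr r by (intro powr_divide)
      ultimately have "((s - a) powr p * green_weight a b r s) / ?M < 1"
        using False by (simp only: green_weight_def if_False times_divide_times_eq)
      then show ?thesis using Mpos by (simp only: divide_less_eq_1_pos)
    qed
  qed
qed

text \<open>Equality would force the continuous nonnegative function \<open>(M - \<phi>) Q\<close> to vanish, hence \<open>Q = 0\<close> off
  the point \<open>s\<^sub>0\<close>, which contradicts positivity of the integral of \<open>\<phi> Q\<close>.\<close>

lemma integral_weight_less:
  fixes \<phi> Q :: "real \<Rightarrow> real"
  assumes "a < b" and c: "continuous_on {a..b} \<phi>" "continuous_on {a..b} Q"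
    and Q: "\<And>s. s \<in> {a..b} \<Longrightarrow> 0 \<le> Q s"
    and less: "\<And>s. s \<in> {a..b} \<Longrightarrow> s \<noteq> s\<^sub>0 \<Longrightarrow> \<phi> s < M"
    and le: "\<And>s. s \<in> {a..b} \<Longrightarrow> \<phi> s \<le> M"
    and pos: "0 < integral {a..b} (\<lambda>s. \<phi> s * Q s)"
  shows "integral {a..b} (\<lambda>s. \<phi> s * Q s) < M * integral {a..b} Q"
proof -
  let ?d = "\<lambda>s. M * Q s - \<phi> s * Q s"
  have cd: "continuous_on {a..b} ?d" "continuous_on {a..b} (\<lambda>s. \<phi> s * Q s)"
    "continuous_on {a..b} (\<lambda>s. M * Q s)"
    by (intro continuous_intros c)+
  have nn: "0 \<le> ?d s" if "s \<in> {a..b}" for s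
    using mult_right_mono[OF le Q, OF that that] by simp
  have "integral {a..b} ?d \<noteq> 0"
  proof
    assume "integral {a..b} ?d = 0"
    then have z: "?d s = 0" if "s \<in> {a..b}" for s
      using integral_eq_0_iff[OF cd(1) assms(1) nn] that by blast
    have "Q s = 0" if "s \<in> {a..b}" "s \<noteq> s\<^sub>0" for s
      using z[of s] less[of s] that by (simp add: left_diff_distrib[symmetric])
    then have "integral {a..b} (\<lambda>s. \<phi> s * Q s) = integral {a..b} (\<lambda>s. 0)"
      by (intro integral_spike[of "{s\<^sub>0}"]) auto
    then show False using pos by simp
  qed
  moreover have "0 \<le> integral {a..b} ?d"
    by (rule integral_nonneg[OF integrable_continuous_real[OF cd(1)] nn])
  moreover have "integral {a..b} ?d = M * integral {a..b} Q - integral {a..b} (\<lambda>s. \<phi> s * Q s)"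
    using Henstock_Kurzweil_Integration.integral_diff[OF integrable_continuous_real[OF cd(3)] integrable_continuous_real[OF cd(2)]]
    by simp
  ultimately show ?thesis by linarith
qed

section \<open>The integral equation and the Lyapunov inequality\<close>

text \<open>The boundary condition expresses \<open>c\<close> as the integral of \<open>h\<close> against the weight; inserting this
  in the formula for \<open>u\<close> and merging the two integrals over \<open>[a,b]\<close> produces the Green function.\<close>

lemma green_representation:
  assumes "a < b" "0 < p" "0 \<le> r" and h: "continuous_on {a..b} h"
    and u: "\<And>t. t \<in> {a..b} \<Longrightarrow>
      u t = c * RL_integral a p (\<lambda>_. 1) t - RL_integral a (p + 1) h t"
    and bc: "c * RL_integral a r (\<lambda>_. 1) b = RL_integral a (r + 1) h b"
    and t: "t \<in> {a..b}"
  shows "Gamma (p + 1) * u t = integral {a..b} (\<lambda>s. green a b p r t s * h s)"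
proof -
  have G: "Gamma (p + 1) \<noteq> 0" "Gamma (r + 1) \<noteq> 0"
    using Gamma_real_pos[of "p + 1"] Gamma_real_pos[of "r + 1"] assms by linarith+
  have ck: "continuous_on {a..b} (green_weight a b r)" using green_weight_continuous_on assms by blast
  have c1: "continuous_on {a..b} (\<lambda>s. green_weight a b r s * h s)"
    by (intro continuous_intros ck h)
  have c2: "continuous_on {a..b} (\<lambda>s. (max 0 (t - s)) powr p * h s)"
    using assms by (intro continuous_intros h continuous_on_powr') auto
  have ba: "0 < (b - a) powr r" using assms by simp
  have "c * ((b - a) powr r) = integral {a..b} (\<lambda>s. (b - s) powr r * h s)"
    using bc RL_integral_const[OF assms(3,1)] assms G by (simp add: RL_integral_def)
  also have "\<dots> = integral {a..b} (\<lambda>s. (b - a) powr r * (green_weight a b r s * h s))"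
  proof (rule integral_spike[of "{b}"])
    fix s assume "s \<in> {a..b} - {b}"
    then show "(b - a) powr r * (green_weight a b r s * h s) = (b - s) powr r * h s"
      using assms ba by (simp add: green_weight_def powr_divide)
  qed simp
  also have "\<dots> = (b - a) powr r * integral {a..b} (\<lambda>s. green_weight a b r s * h s)" by simp
  finally have c: "c = integral {a..b} (\<lambda>s. green_weight a b r s * h s)" using ba by simp
  have "RL_integral a p (\<lambda>_. 1) t = (t - a) powr p / Gamma (p + 1)"
  proof (cases "t = a")
    case True
    then show ?thesis using assms by (simp add: RL_integral_def)
  next
    case False
    then show ?thesis using RL_integral_const[of p a t] assms by simp
  qed
  moreover have "Gamma (p + 1) * RL_integral a (p + 1) h t = integral {a..b} (\<lambda>s. (max 0 (t - s)) powr p * h s)"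
  proof -
    have "integral {a..t} (\<lambda>s. (t - s) powr p * h s)
        = integral {a..b} (\<lambda>s. if s \<in> {a..t} then (t - s) powr p * h s else 0)"
      using integral_restrict_Int[of "{a..b}" "{a..t}" "\<lambda>s. (t - s) powr p * h s"] t
      by (simp only: Int_absorb2 atLeastatMost_subset_iff atLeastAtMost_iff) simp
    also have "\<dots> = integral {a..b} (\<lambda>s. (max 0 (t - s)) powr p * h s)"
      by (rule integral_cong) auto
    finally show ?thesis using assms G by (simp add: RL_integral_def)
  qed
  ultimately have "Gamma (p + 1) * u t = (t - a) powr p * integral {a..b} (\<lambda>s. green_weight a b r s * h s)
      - integral {a..b} (\<lambda>s. (max 0 (t - s)) powr p * h s)"
    using u[OF t] c G by (simp add: right_diff_distrib)
  also have "\<dots> = integral {a..b} (\<lambda>s. (t - a) powr p * (green_weight a b r s * h s))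
      - integral {a..b} (\<lambda>s. (max 0 (t - s)) powr p * h s)" by simp
  also have "\<dots> = integral {a..b} (\<lambda>s. (t - a) powr p * (green_weight a b r s * h s) - (max 0 (t - s)) powr p * h s)"
    by (rule Henstock_Kurzweil_Integration.integral_diff[symmetric]; intro integrable_continuous_real continuous_intros c1 c2)
  also have "\<dots> = integral {a..b} (\<lambda>s. green a b p r t s * h s)"
    by (simp add: green_def algebra_simps)
  finally show ?thesis .
qed

lemma nonvanishing_eq_sgn_abs:
  fixes u :: "real \<Rightarrow> real"
  assumes "a < b" "continuous_on {a..b} u" "\<forall>t\<in>{a<..<b}. u t \<noteq> 0"
  obtains \<sigma> where "\<And>t. t \<in> {a..b} \<Longrightarrow> \<bar>u t\<bar> = \<sigma> * u t"
proof -
  have ext: "\<forall>t\<in>{a..b}. 0 \<le> v t" if "continuous_on {a..b} v" "\<forall>t\<in>{a<..<b}. 0 < v t" for v :: "real \<Rightarrow> real"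
    using continuous_ge_on_closure[of "{a<..<b}" v _ 0] that assms(1) by (auto simp: less_imp_le)
  have "(\<forall>t\<in>{a<..<b}. 0 < u t) \<or> (\<forall>t\<in>{a<..<b}. u t < 0)"
  proof (rule ccontr)
    assume "\<not> ?thesis"
    then obtain x y where xy: "x \<in> {a<..<b}" "y \<in> {a<..<b}" "u x < 0" "0 < u y"
      using assms(3) by (metis linorder_neqE_linordered_idom)
    have "connected (u ` {a<..<b})"
      by (rule connected_continuous_image[OF continuous_on_subset[OF assms(2)]]) auto
    moreover have "u x \<in> u ` {a<..<b}" "u y \<in> u ` {a<..<b}" using xy by auto
    ultimately have "0 \<in> u ` {a<..<b}" using connectedD_interval xy by (metis less_imp_le)
    then show False using assms(3) by auto
  qed
  then show ?thesis
  proof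
    assume "\<forall>t\<in>{a<..<b}. 0 < u t"
    then have "\<bar>u t\<bar> = 1 * u t" if "t \<in> {a..b}" for t
      using ext[OF assms(2)] that by simp
    then show ?thesis using that by blast
  next
    assume "\<forall>t\<in>{a<..<b}. u t < 0"
    then have "\<bar>u t\<bar> = - 1 * u t" if "t \<in> {a..b}" for t
      using ext[OF continuous_on_minus[OF assms(2)]] that by fastforce
    then show ?thesis using that by blast
  qed
qed

theorem theorem3p1:
  fixes a b \<alpha> \<beta> :: real and q u :: "real \<Rightarrow> real"
  assumes "a < b"
    and "1 < \<alpha>" and "\<alpha> \<le> 2"
    and "0 \<le> \<beta>" and "\<beta> \<le> \<alpha> - 1"
    and "continuous_on {a..b} q"
    and "RL_solution a b \<alpha> q u"
    and "\<exists>t\<in>{a..b}. u t \<noteq> 0"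
    and "u a = 0"
    and "has_RL_derivative a b \<beta> u 0 b"
    and "\<forall>t\<in>{a<..<b}. u t \<noteq> 0"
  shows "integral {a..b} (\<lambda>t. max (q t) 0) >
     Gamma \<alpha> * ((2 * \<alpha> - 2 - \<beta>) / ((b - a) * (\<alpha> - 1))) powr (\<alpha> - 1)
       * (if \<beta> = \<alpha> - 1 then 1
          else ((2 * \<alpha> - 2 - \<beta>) / (\<alpha> - 1 - \<beta>)) powr (\<alpha> - 1 - \<beta>))"
proof -
  define p r where "p = \<alpha> - 1" and "r = \<alpha> - 1 - \<beta>"
  have pr: "0 < p" "p \<le> 1" "0 \<le> r" "r \<le> p" using assms(2-5) by (auto simp: p_def r_def)
  have u: "continuous_on {a..b} u" using assms(7) by (simp add: RL_solution_def)
  define h where "h t = q t * u t" for t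
  have h: "continuous_on {a..b} h" unfolding h_def[abs_def] by (intro continuous_intros assms(6) u)
  have D: "has_RL_derivative a b \<alpha> u (- h t) t" if "t \<in> {a..b}" for t
    using assms(7) that by (auto simp: RL_solution_def h_def add_eq_0_iff2)
  obtain c where c: "\<And>t. t \<in> {a..b} \<Longrightarrow>
      u t = c * RL_integral a (\<alpha> - 1) (\<lambda>_. 1) t - RL_integral a \<alpha> h t"
    using RL_derivative_inversion[OF assms(1-3) u assms(9) h D] by blast
  have bc: "c * RL_integral a r (\<lambda>_. 1) b = RL_integral a (r + 1) h b"
    using RL_derivative_boundary_value[OF assms(1-5) h c assms(10)] by (simp add: r_def)
  have rep: "Gamma \<alpha> * u t = integral {a..b} (\<lambda>s. green a b p r t s * h s)" if "t \<in> {a..b}" for t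
    using green_representation[OF assms(1) pr(1,3) h _ bc that, of u] c by (simp add: p_def)

  obtain \<sigma> where \<sigma>: "\<And>t. t \<in> {a..b} \<Longrightarrow> \<bar>u t\<bar> = \<sigma> * u t"
    using nonvanishing_eq_sgn_abs[OF assms(1) u assms(11)] by blast
  have ca: "continuous_on {a..b} (\<lambda>t. \<bar>u t\<bar>)" by (intro continuous_intros u)
  obtain t\<^sub>0 where t0: "t\<^sub>0 \<in> {a..b}" "\<And>t. t \<in> {a..b} \<Longrightarrow> \<bar>u t\<bar> \<le> \<bar>u t\<^sub>0\<bar>"
    using continuous_attains_sup[OF _ _ ca] assms(1) by auto
  define m where "m = \<bar>u t\<^sub>0\<bar>"
  have m: "0 < m"
  proof -
    obtain t where "t \<in> {a..b}" "u t \<noteq> 0" using assms(8) by blast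
    then show ?thesis using t0(2)[of t] by (simp add: m_def)
  qed

  define Q where "Q t = max (q t) 0" for t
  define \<phi> where "\<phi> s = (s - a) powr p * green_weight a b r s" for s
  define M where "M = ((b - a) * p / (p + r)) powr p * (if r = 0 then 1 else (r / (p + r)) powr r)"
  define s\<^sub>0 where "s\<^sub>0 = a + (b - a) * p / (p + r)"
  have cQ: "continuous_on {a..b} Q" unfolding Q_def[abs_def] by (intro continuous_intros assms(6))
  have c\<phi>: "continuous_on {a..b} \<phi>"
    unfolding \<phi>_def[abs_def] using pr assms(1)
    by (intro continuous_intros green_weight_continuous_on continuous_on_powr') auto
  have less: "\<phi> s < M" if "s \<in> {a..b}" "s \<noteq> s\<^sub>0" for s
    using diagonal_less_max[OF assms(1) pr(1,3) that[unfolded s\<^sub>0_def]] by (simp add: \<phi>_def M_def)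

  \<comment> \<open>The integral equation for \<open>\<bar>u\<bar> = \<sigma> u\<close> at its maximum, with \<open>q \<bar>u\<bar> \<le> q\<^sub>+ m\<close> and \<open>g \<le> \<phi>\<close>.\<close>
  have "Gamma \<alpha> * m = integral {a..b} (\<lambda>s. \<sigma> * (green a b p r t\<^sub>0 s * h s))"
    using rep[OF t0(1)] \<sigma>[OF t0(1)] by (simp add: m_def)
  also have "\<dots> \<le> integral {a..b} (\<lambda>s. m * (\<phi> s * Q s))"
  proof (rule integral_le)
    show "(\<lambda>s. \<sigma> * (green a b p r t\<^sub>0 s * h s)) integrable_on {a..b}"
      by (intro integrable_continuous_real continuous_intros green_continuous_on assms(1) pr h)
    show "(\<lambda>s. m * (\<phi> s * Q s)) integrable_on {a..b}"
      by (intro integrable_continuous_real continuous_intros c\<phi> cQ)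
    fix s assume s: "s \<in> {a..b}"
    have g: "0 \<le> green a b p r t\<^sub>0 s" by (rule green_nonneg[OF assms(1) pr(1,3,4) t0(1) s])
    have "\<sigma> * (green a b p r t\<^sub>0 s * h s) = green a b p r t\<^sub>0 s * (q s * \<bar>u s\<bar>)"
      using \<sigma>[OF s] by (simp add: h_def mult_ac)
    also have "\<dots> \<le> \<phi> s * (Q s * m)"
    proof -
      have gw: "green a b p r t\<^sub>0 s \<le> \<phi> s"
        using green_le_diagonal[OF assms(1) pr(1-3) t0(1) s] by (simp add: \<phi>_def)
      have "q s * \<bar>u s\<bar> \<le> Q s * \<bar>u s\<bar>" by (intro mult_right_mono) (auto simp: Q_def)
      also have "\<dots> \<le> Q s * m" using t0(2)[OF s] by (intro mult_left_mono) (auto simp: m_def Q_def)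
      finally have "green a b p r t\<^sub>0 s * (q s * \<bar>u s\<bar>) \<le> green a b p r t\<^sub>0 s * (Q s * m)"
        using g by (intro mult_left_mono)
      also have "\<dots> \<le> \<phi> s * (Q s * m)"
        using gw m by (intro mult_right_mono) (auto simp: Q_def)
      finally show ?thesis .
    qed
    finally show "\<sigma> * (green a b p r t\<^sub>0 s * h s) \<le> m * (\<phi> s * Q s)" by (simp add: mult_ac)
  qed
  also have "\<dots> = m * integral {a..b} (\<lambda>s. \<phi> s * Q s)" by simp
  finally have "Gamma \<alpha> \<le> integral {a..b} (\<lambda>s. \<phi> s * Q s)" using m by (simp add: mult.commute)
  moreover have "0 < Gamma \<alpha>" using assms(2) by (simp add: Gamma_real_pos)
  moreover have le: "\<phi> s \<le> M" if "s \<in> {a..b}" for s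
  proof (cases "s = s\<^sub>0")
    case True
    have "\<phi> s\<^sub>0 = M"
    proof -
      have "b - s\<^sub>0 = (b - a) * r / (p + r)" using pr by (simp add: s\<^sub>0_def field_simps)
      then show ?thesis using assms(1) by (simp add: \<phi>_def M_def green_weight_def s\<^sub>0_def)
    qed
    then show ?thesis using True by simp
  qed (use less that in fastforce)
  ultimately have "Gamma \<alpha> < M * integral {a..b} Q"
    using integral_weight_less[OF assms(1) c\<phi> cQ _ less le] by (force simp: Q_def)
  moreover have "0 < M" using pr assms(1) by (auto simp: M_def)
  ultimately have "Gamma \<alpha> / M < integral {a..b} Q" by (simp add: divide_less_eq mult.commute)
  moreover have "Gamma \<alpha> / M = Gamma \<alpha> * ((2 * \<alpha> - 2 - \<beta>) / ((b - a) * (\<alpha> - 1))) powr (\<alpha> - 1)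
       * (if \<beta> = \<alpha> - 1 then 1
          else ((2 * \<alpha> - 2 - \<beta>) / (\<alpha> - 1 - \<beta>)) powr (\<alpha> - 1 - \<beta>))"
  proof -
    have "2 * \<alpha> - 2 - \<beta> = p + r" by (simp add: p_def r_def)
    moreover have "\<beta> = \<alpha> - 1 \<longleftrightarrow> r = 0" by (auto simp: r_def)
    moreover have "((p + r) / ((b - a) * p)) powr p = 1 / ((b - a) * p / (p + r)) powr p"
      using pr assms(1) powr_divide[of 1 "(b - a) * p / (p + r)" p] by simp
    moreover have "((p + r) / r) powr r = 1 / (r / (p + r)) powr r"
      using pr powr_divide[of 1 "r / (p + r)" r] by simp
    ultimately show ?thesis
      unfolding M_def unfolding r_def[symmetric] unfolding p_def[symmetric] by simp
  qed
  ultimately show ?thesis unfolding Q_def by simp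
qed

end
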